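(* Let $(G,\mathcal{F},\{U_e\}_{e\in E})$ be a coordination sheaf on an undirected graph $G=(V,E)$ with $V=\{1,\dots,N\}$, with coboundary operator $\delta_{\mathcal{F}}$, global potential $U$, Dirichlet energy $f=U\circ\delta_{\mathcal{F}}$, and nonlinear sheaf Laplacian $L_{\mathcal{F}}^{\nabla U}$. Assume that each $U_e$ is $m_e$-strongly convex for some $m_e>0$ and $K_e$-smooth for some $K_e>0$, that the minimizer set $\mathcal{X}^*=\{\mathbf{x}\in C^0(G;\mathcal{F}) \mid L_{\mathcal{F}}^{\nabla U}\mathbf{x}=0\}$ is nonempty, and that the update sets $T_i$ and delayed time indices $\tau^i_j(t)$ satisfy the partial asynchrony assumption with delay bound $B$. Then there exists $\gamma_0>0$ such that if the step size satisfies $\gamma\in(0,\gamma_0)$, then the sequences $$\alpha(t)=f(\mathbf{x}(t))-f^*,\qquad \beta(t)=\sum_{\tau=t-B-1}^{t-1}\|\mathbf{x}(\tau+1)-\mathbf{x}(\tau)\|^2$$ generated by the partially asynchronous sheaf diffusion algorithm with step size $\gamma$ satisfy, for all $r\in\mathbb{N}$, $$\alpha\big(r(B+1)\big)\leq a(1-\gamma c)^r,\qquad \beta\big(r(B+1)\big)\leq b(1-\gamma c)^r,$$ where $a$, $b$, and $c<\frac{1}{\gamma}$ are positive constants (independent of $r$).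
   Context: Coordination sheaf. A (Euclidean) cellular sheaf $\mathcal{F}$ over a (finite) undirected graph $G=(V,E)$ assigns a finite-dimensional real inner product space $\mathcal{F}(i)$ to each node $i\in V$, a finite-dimensional real inner product space $\mathcal{F}(ij)$ to each edge $ij\in E$, and a linear map $\mathcal{F}_{i\trianglelefteq ij}:\mathcal{F}(i)\to\mathcal{F}(ij)$ for every $i\in V$ and $j\in N_i$, where $N_i=\{j\in V\mid ij\in E\}$. Put $C^0(G;\mathcal{F})=\bigoplus_{i\in V}\mathcal{F}(i)$ and $C^1(G;\mathcal{F})=\bigoplus_{e\in E}\mathcal{F}(e)$ with the direct-sum inner products and induced norms. With an arbitrary fixed orientation of each edge, the coboundary operator $\delta_{\mathcal{F}}:C^0(G;\mathcal{F})\to C^1(G;\mathcal{F})$ is $(\delta_{\mathcal{F}}\mathbf{x})_{ij}=\mathcal{F}_{i\trianglelefteq ij}(x_i)-\mathcal{F}_{j\trianglelefteq ij}(x_j)$. A coordination sheaf consists of $G$, a cellular sheaf $\mathcal{F}$ over $G$, and differentiable edge potentials $U_e:\mathcal{F}(e)\to\mathbb{R}$, $e\in E$. The global potential is $U:C^1(G;\mathcal{F})\to\mathbb{R}$, $U(\mathbf{y})=\sum_{e\in E}U_e(y_e)$. The Dirichlet energy is $f=U\circ\delta_{\mathcal{F}}:C^0(G;\mathcal{F})\to\mathbb{R}$, and $f^*=\inf_{\mathbf{x}}f(\mathbf{x})$. The nonlinear sheaf Laplacian is $L_{\mathcal{F}}^{\nabla U}=\delta_{\mathcal{F}}^{\top}\circ\nabla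 U\circ\delta_{\mathcal{F}}=\nabla f$, where $\delta_{\mathcal{F}}^\top$ is the transpose (adjoint) of $\delta_{\mathcal{F}}$; $[\,\cdot\,]_i$ denotes the component in $\mathcal{F}(i)$. Strong convexity: $\langle\nabla U_e(x_e)-\nabla U_e(y_e),x_e-y_e\rangle\geq m_e\|x_e-y_e\|^2$ for all $x_e,y_e\in\mathcal{F}(e)$. Smoothness: $\|\nabla U_e(x_e)-\nabla U_e(y_e)\|\leq K_e\|x_e-y_e\|$ for all $x_e,y_e\in\mathcal{F}(e)$. Algorithm (partially asynchronous sheaf diffusion). Let $T_i\subseteq\mathbb{N}$ be the set of iterations at which agent $i$ computes, and let $\tau^i_j(t)$ be the time index of the value of $x_j$ available to agent $i$ at iteration $t$. Given arbitrary initial values $x_i(0)\in\mathcal{F}(i)$ and $\gamma>0$, for all $i\in V$ and $t\in\mathbb{N}$, $$x_i(t+1)=\begin{cases}x_i(t), & t\notin T_i,\\ x_i(t)-\gamma\big[L_{\mathcal{F}}^{\nabla U}\mathbf{x}^i(t)\big]_i, & t\in T_i,\end{cases}\qquad \mathbf{x}^i(t)=\big(x_1(\tau^i_1(t)),\dots,x_N(\tau^i_N(t))\big),$$ and $\mathbf{x}(t)=(x_1(t),\dots,x_N(t))$. Convention: $0\in\mathbb{N}$ and $\mathbf{x}(t)=\mathbf{x}(0)$ for $t<0$. Partial asynchrony assumption with delay bound $B$ (an integer $B\geq 0$): (a) $\{t,t+1,\dots,t+B\}\cap T_i\neq\emptyset$ for every $i\in V$ and every $t\in\mathbb{N}$;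 (b) $t-B\leq\tau^i_j(t)\leq t$ for all $i\in V$, $j\in N_i$, $t\in T_i$; (c) $\tau^i_i(t)=t$ for all $i\in V$, $t\in T_i$. *)

theory Defs
  imports "HOL-Analysis.Analysis"
begin

(* The node set is the whole finite type 'v and edges are unordered pairs of nodes.
   Stalks vary with the node or edge, so they are linear subspaces of common Euclidean
   spaces 'a (nodes) and 'b (edges), with the inherited inner product; every finite family
   of finite-dimensional inner product spaces is isometric to such a family.
   "orient e" lists the two endpoints of e in a chosen order. Loops are not
   excluded; they contribute 0 to the coboundary. *)

record ('v, 'a, 'b) cellular_sheaf =
  edges :: "'v set set"
  orient :: "'v set \<Rightarrow> 'v \<times> 'v"
  node_stalk :: "'v \<Rightarrow> 'a set"
  edge_stalk :: "'v set \<Rightarrow> 'b set"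
  restr :: "'v \<Rightarrow> 'v set \<Rightarrow> 'a \<Rightarrow> 'b"

definition nbrs :: "('v, 'a, 'b) cellular_sheaf \<Rightarrow> 'v \<Rightarrow> 'v set" where
  "nbrs F i = {j. {i, j} \<in> edges F}"

definition linear_between ::
  "'a::real_vector set \<Rightarrow> 'b::real_vector set \<Rightarrow> ('a \<Rightarrow> 'b) \<Rightarrow> bool" where
  "linear_between S T g \<longleftrightarrow>
     g ` S \<subseteq> T \<and>
     (\<forall>x\<in>S. \<forall>y\<in>S. g (x + y) = g x + g y) \<and>
     (\<forall>c. \<forall>x\<in>S. g (c *\<^sub>R x) = c *\<^sub>R g x)"

definition is_cellular_sheaf ::
  "('v::finite, 'a::euclidean_space, 'b::euclidean_space) cellular_sheaf \<Rightarrow> bool" where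
  "is_cellular_sheaf F \<longleftrightarrow>
     (\<forall>e\<in>edges F. e = {fst (orient F e), snd (orient F e)}) \<and>
     (\<forall>i. subspace (node_stalk F i)) \<and>
     (\<forall>e\<in>edges F. subspace (edge_stalk F e)) \<and>
     (\<forall>i. \<forall>j\<in>nbrs F i.
        linear_between (node_stalk F i) (edge_stalk F {i, j}) (restr F i {i, j}))"

(* C^0 and C^1 are subspaces of 'a ^ 'v and 'b ^ ('v set), whose inner product is the sum of
   the componentwise ones. Coordinates indexed by non-edges are 0. *)

definition C0 :: "('v::finite, 'a::euclidean_space, 'b) cellular_sheaf \<Rightarrow> ('a ^ 'v) set" where
  "C0 F = {x. \<forall>i. x $ i \<in> node_stalk F i}"

definition C1 ::
  "('v::finite, 'a, 'b::euclidean_space) cellular_sheaf \<Rightarrow> ('b ^ ('v set)) set" where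
  "C1 F = {y. (\<forall>e\<in>edges F. y $ e \<in> edge_stalk F e) \<and> (\<forall>e. e \<notin> edges F \<longrightarrow> y $ e = 0)}"

definition coboundary ::
  "('v::finite, 'a::euclidean_space, 'b::euclidean_space) cellular_sheaf
     \<Rightarrow> 'a ^ 'v \<Rightarrow> 'b ^ ('v set)" where
  "coboundary F x =
     (\<chi> e. if e \<in> edges F
           then (case orient F e of (i, j) \<Rightarrow> restr F i e (x $ i) - restr F j e (x $ j))
           else 0)"

(* Adjoint and gradient relative to subspaces S (and the ambient space restricted to S).
   The gradient is the representing vector of the derivative that lies in S itself. *)

definition adjoint_on :: "'a::real_inner set \<Rightarrow> ('a \<Rightarrow> 'b::real_inner) \<Rightarrow> 'b \<Rightarrow> 'a" where
  "adjoint_on S g y = (THE z. z \<in> S \<and> (\<forall>x\<in>S. inner (g x) y = inner x z))"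

definition grad_on :: "'a::real_inner set \<Rightarrow> ('a \<Rightarrow> real) \<Rightarrow> 'a \<Rightarrow> 'a" where
  "grad_on S g y = (THE v. v \<in> S \<and> (g has_derivative (\<lambda>h. inner v h)) (at y within S))"

definition strongly_convex_on :: "'a::real_inner set \<Rightarrow> real \<Rightarrow> ('a \<Rightarrow> real) \<Rightarrow> bool" where
  "strongly_convex_on S m g \<longleftrightarrow>
     (\<forall>x\<in>S. \<forall>y\<in>S. inner (grad_on S g x - grad_on S g y) (x - y) \<ge> m * (norm (x - y))\<^sup>2)"

definition smooth_on_with :: "'a::real_inner set \<Rightarrow> real \<Rightarrow> ('a \<Rightarrow> real) \<Rightarrow> bool" where
  "smooth_on_with S K g \<longleftrightarrow>
     (\<forall>x\<in>S. \<forall>y\<in>S. norm (grad_on S g x - grad_on S g y) \<le> K * norm (x - y))"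

definition coordination_sheaf ::
  "('v::finite, 'a::euclidean_space, 'b::euclidean_space) cellular_sheaf
     \<Rightarrow> ('v set \<Rightarrow> 'b \<Rightarrow> real) \<Rightarrow> bool" where
  "coordination_sheaf F U \<longleftrightarrow>
     is_cellular_sheaf F \<and> (\<forall>e\<in>edges F. U e differentiable_on edge_stalk F e)"

definition global_potential ::
  "('v::finite, 'a, 'b::euclidean_space) cellular_sheaf
     \<Rightarrow> ('v set \<Rightarrow> 'b \<Rightarrow> real) \<Rightarrow> 'b ^ ('v set) \<Rightarrow> real" where
  "global_potential F U y = (\<Sum>e\<in>edges F. U e (y $ e))"

definition dirichlet_energy ::
  "('v::finite, 'a::euclidean_space, 'b::euclidean_space) cellular_sheaf
     \<Rightarrow> ('v set \<Rightarrow> 'b \<Rightarrow> real) \<Rightarrow> 'a ^ 'v \<Rightarrow> real" where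
  "dirichlet_energy F U = global_potential F U \<circ> coboundary F"

definition min_energy ::
  "('v::finite, 'a::euclidean_space, 'b::euclidean_space) cellular_sheaf
     \<Rightarrow> ('v set \<Rightarrow> 'b \<Rightarrow> real) \<Rightarrow> real" where
  "min_energy F U = (INF x\<in>C0 F. dirichlet_energy F U x)"

definition sheaf_laplacian ::
  "('v::finite, 'a::euclidean_space, 'b::euclidean_space) cellular_sheaf
     \<Rightarrow> ('v set \<Rightarrow> 'b \<Rightarrow> real) \<Rightarrow> 'a ^ 'v \<Rightarrow> 'a ^ 'v" where
  "sheaf_laplacian F U =
     adjoint_on (C0 F) (coboundary F) \<circ> grad_on (C1 F) (global_potential F U) \<circ> coboundary F"

definition minimizers ::
  "('v::finite, 'a::euclidean_space, 'b::euclidean_space) cellular_sheaf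
     \<Rightarrow> ('v set \<Rightarrow> 'b \<Rightarrow> real) \<Rightarrow> ('a ^ 'v) set" where
  "minimizers F U = {x \<in> C0 F. sheaf_laplacian F U x = 0}"

(* Delayed indices "tau i j t" may be negative, so time is int in trajectories. *)

definition partially_asynchronous ::
  "('v::finite, 'a, 'b) cellular_sheaf \<Rightarrow> nat \<Rightarrow> ('v \<Rightarrow> nat set)
     \<Rightarrow> ('v \<Rightarrow> 'v \<Rightarrow> nat \<Rightarrow> int) \<Rightarrow> bool" where
  "partially_asynchronous F B T \<tau> \<longleftrightarrow>
     (\<forall>i t. {t..t + B} \<inter> T i \<noteq> {}) \<and>
     (\<forall>i. \<forall>j\<in>nbrs F i. \<forall>t\<in>T i. int t - int B \<le> \<tau> i j t \<and> \<tau> i j t \<le> int t) \<and>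
     (\<forall>i. \<forall>t\<in>T i. \<tau> i i t = int t)"

definition async_sheaf_diffusion ::
  "('v::finite, 'a::euclidean_space, 'b::euclidean_space) cellular_sheaf
     \<Rightarrow> ('v set \<Rightarrow> 'b \<Rightarrow> real) \<Rightarrow> ('v \<Rightarrow> nat set) \<Rightarrow> ('v \<Rightarrow> 'v \<Rightarrow> nat \<Rightarrow> int)
     \<Rightarrow> real \<Rightarrow> (int \<Rightarrow> 'a ^ 'v) \<Rightarrow> bool" where
  "async_sheaf_diffusion F U T \<tau> \<gamma> x \<longleftrightarrow>
     x 0 \<in> C0 F \<and>
     (\<forall>t<0. x t = x 0) \<and>
     (\<forall>i. \<forall>t::nat. x (int t + 1) $ i =
        (if t \<in> T i
         then x (int t) $ i - \<gamma> *\<^sub>R (sheaf_laplacian F U (\<chi> j. x (\<tau> i j t) $ j) $ i)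
         else x (int t) $ i))"

definition energy_gap ::
  "('v::finite, 'a::euclidean_space, 'b::euclidean_space) cellular_sheaf
     \<Rightarrow> ('v set \<Rightarrow> 'b \<Rightarrow> real) \<Rightarrow> (int \<Rightarrow> 'a ^ 'v) \<Rightarrow> int \<Rightarrow> real" where
  "energy_gap F U x t = dirichlet_energy F U (x t) - min_energy F U"

definition recent_variation ::
  "nat \<Rightarrow> (int \<Rightarrow> 'a::euclidean_space ^ 'v::finite) \<Rightarrow> int \<Rightarrow> real" where
  "recent_variation B x t = (\<Sum>s = t - int B - 1..t - 1. (norm (x (s + 1) - x s))\<^sup>2)"

end

theory Submission
  imports Defs
begin

text \<open>
  Partially asynchronous sheaf diffusion is coordinatewise gradient descent with delays on the
  Dirichlet energy \<open>f\<close>. Two properties of \<open>f\<close> on the space of 0-cochains drive the convergence: its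
  gradient, the nonlinear sheaf Laplacian, is Lipschitz with some constant \<open>\<Lambda>\<close>, and the gap
  \<open>f x - f\<^sup>*\<close> is at most a constant times \<open>(norm (gradient x))\<^sup>2\<close>. The second one is a
  Polyak--Lojasiewicz inequality. It holds although the coboundary \<open>\<delta>\<close> may have a kernel, because
  the potential is strongly convex and every \<open>\<delta> x\<close> has a preimage whose norm is at most a constant
  times the norm of \<open>\<delta> x\<close> (\<open>strongly_convex_composite.gap_le_gradient_squared\<close>).

  Write \<open>\<alpha>\<close>, \<open>\<beta>\<close> for the energy gap and the recent variation at the start of a window of \<open>B + 1\<close>
  iterations, and \<open>\<alpha>'\<close>, \<open>\<beta>'\<close> for their values at its end. A delayed view differs from the current
  state by at most the increments of the last \<open>B\<close> iterations, so the descent inequality, summed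
  over the window, gives \<open>\<alpha>' \<le> \<alpha> - (1 / \<gamma> - D) * \<beta>' + D * \<beta>\<close> with \<open>D\<close> depending on \<open>\<Lambda>\<close>, \<open>B\<close> and the
  number of nodes only (\<open>partially_asynchronous_descent.energy_one_window\<close>). Conversely each node
  acts at least once in the window, so its gradient is visible in its step up to the same kind of
  error, and the Polyak--Lojasiewicz inequality gives \<open>\<alpha> \<le> E / \<gamma>\<^sup>2 * \<beta>' + E * (\<beta> + \<beta>')\<close>
  (\<open>partially_asynchronous_descent.gap_le_variation\<close>). If \<open>\<gamma> < 1 / (4 * D)\<close>, eliminating \<open>\<beta>'\<close> shows
  that \<open>\<alpha> + 2 * D * \<beta>\<close> shrinks by a fixed factor over each window (\<open>lyapunov_contraction\<close>), and both
  sequences are dominated by this Lyapunov function.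
\<close>

section \<open>Gradients and adjoints relative to a subspace\<close>

lemma orthogonal_projection_exists:
  fixes w :: "'a::euclidean_space"
  assumes "subspace S"
  obtains z where "z \<in> S" "\<And>x. x \<in> S \<Longrightarrow> inner x w = inner x z"
proof -
  obtain y z where yz: "y \<in> span S" "\<And>u. u \<in> span S \<Longrightarrow> orthogonal z u" "w = y + z"
    using orthogonal_subspace_decomp_exists by blast
  show thesis
  proof
    show "y \<in> S" using yz(1) assms by (metis span_eq_iff)
    show "inner x w = inner x y" if "x \<in> S" for x
      using yz(2)[OF span_base[OF that]] yz(3)
      by (simp add: inner_add_right orthogonal_def inner_commute)
  qed
qed

lemma eq_if_inner_eq_on_subspace:
  assumes "subspace S" "u \<in> S" "v \<in> S" "\<And>x. x \<in> S \<Longrightarrow> inner x u = inner x v"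
  shows "u = v"
proof -
  have "inner (u - v) (u - v) = 0"
    using assms(4)[OF subspace_diff[OF assms(1,2,3)]] by (simp add: inner_diff_right)
  then show ?thesis by simp
qed

text \<open>Maps that are linear only between stalks extend to the ambient spaces, which makes the
  theory of globally linear maps (boundedness, adjoints, right inverses) applicable to them.\<close>

lemma linear_between_extend:
  fixes g :: "'a::euclidean_space \<Rightarrow> 'b::euclidean_space"
  assumes S: "subspace S" and g: "linear_between S T g"
  obtains g' where "linear g'" "\<And>x. x \<in> S \<Longrightarrow> g' x = g x"
proof -
  obtain B where B: "B \<subseteq> S" "independent B" "S \<subseteq> span B"
    using basis_exists by metis
  obtain g' where g': "linear g'" "\<forall>x\<in>B. g' x = g x"
    using linear_independent_extend[OF B(2)] by metis
  have sub: "subspace {x \<in> S. g' x = g x}"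
    unfolding subspace_def
  proof (intro conjI ballI allI)
    have "g (0 *\<^sub>R 0) = 0 *\<^sub>R g 0"
      using g subspace_0[OF S] unfolding linear_between_def by blast
    then show "0 \<in> {x \<in> S. g' x = g x}"
      using subspace_0[OF S] linear_0[OF g'(1)] by simp
  next
    fix x y assume "x \<in> {x \<in> S. g' x = g x}" "y \<in> {x \<in> S. g' x = g x}"
    then show "x + y \<in> {x \<in> S. g' x = g x}"
      using g subspace_add[OF S] linear_add[OF g'(1)] unfolding linear_between_def by simp
  next
    fix c x assume "x \<in> {x \<in> S. g' x = g x}"
    then show "c *\<^sub>R x \<in> {x \<in> S. g' x = g x}"
      using g subspace_scale[OF S] linear_scale[OF g'(1)] unfolding linear_between_def by simp
  qed
  have "span B \<subseteq> {x \<in> S. g' x = g x}"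
    by (rule span_minimal) (use B g' sub in auto)
  with B(3) g'(1) that show thesis by blast
qed

lemma adjoint_on:
  fixes g :: "'a::euclidean_space \<Rightarrow> 'b::euclidean_space"
  assumes S: "subspace S" and g: "linear_between S T g"
  shows adjoint_on_in: "adjoint_on S g y \<in> S"
    and inner_adjoint_on: "x \<in> S \<Longrightarrow> inner x (adjoint_on S g y) = inner (g x) y"
proof -
  obtain g' where g': "linear g'" "\<And>x. x \<in> S \<Longrightarrow> g' x = g x"
    using linear_between_extend[OF S g] by blast
  obtain z where z: "z \<in> S" "\<And>x. x \<in> S \<Longrightarrow> inner x (adjoint g' y) = inner x z"
    using orthogonal_projection_exists[OF S] by blast
  have *: "z \<in> S \<and> (\<forall>x\<in>S. inner (g x) y = inner x z)"
    using z g' adjoint_works[OF g'(1)] by metis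
  have "adjoint_on S g y \<in> S \<and> (\<forall>x\<in>S. inner (g x) y = inner x (adjoint_on S g y))"
    unfolding adjoint_on_def
  proof (rule theI')
    show "\<exists>!z. z \<in> S \<and> (\<forall>x\<in>S. inner (g x) y = inner x z)"
      using * eq_if_inner_eq_on_subspace[OF S] by (intro ex_ex1I) auto
  qed
  then show "adjoint_on S g y \<in> S" "x \<in> S \<Longrightarrow> inner x (adjoint_on S g y) = inner (g x) y"
    by auto
qed

text \<open>A derivative within a subspace is a linear functional on the whole space, determined only
  along the subspace; hence the representing vector is unique once it is required to lie there.\<close>

lemma grad_on_eqI:
  fixes g :: "'a::euclidean_space \<Rightarrow> real"
  assumes S: "subspace S" and y: "y \<in> S" and v: "v \<in> S"
    and d: "(g has_derivative (\<lambda>h. inner v h)) (at y within S)"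
  shows "grad_on S g y = v"
  unfolding grad_on_def
proof (rule the_equality)
  show "v \<in> S \<and> (g has_derivative (\<lambda>h. inner v h)) (at y within S)" using v d by simp
next
  fix u assume u: "u \<in> S \<and> (g has_derivative (\<lambda>h. inner u h)) (at y within S)"
  show "u = v"
  proof (rule eq_if_inner_eq_on_subspace[OF S])
    show "u \<in> S" "v \<in> S" using u v by auto
    fix x assume x: "x \<in> S"
    have mem: "y + t *\<^sub>R x \<in> S" for t :: real
      using S x y by (simp add: subspace_add subspace_scale)
    have line: "((\<lambda>t::real. y + t *\<^sub>R x) has_derivative (\<lambda>t. t *\<^sub>R x)) (at 0)"
      by (auto intro!: derivative_eq_intros)
    have comp: "((\<lambda>t. g (y + t *\<^sub>R x)) has_derivative (\<lambda>t. inner w (t *\<^sub>R x))) (at 0)"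
      if "(g has_derivative (\<lambda>h. inner w h)) (at y within S)" for w
    proof -
      have "(g has_derivative (\<lambda>h. inner w h))
          (at (y + 0 *\<^sub>R x) within range (\<lambda>t::real. y + t *\<^sub>R x))"
        using that by (auto intro: has_derivative_subset simp: mem image_subset_iff)
      from has_derivative_in_compose[OF line this] show ?thesis by simp
    qed
    have "(\<lambda>t. inner u (t *\<^sub>R x)) = (\<lambda>t. inner v (t *\<^sub>R x))"
      using comp[of u] comp[of v] u d has_derivative_unique by blast
    from fun_cong[OF this, of 1] show "inner x u = inner x v" by (simp add: inner_commute)
  qed
qed

lemma grad_on:
  fixes g :: "'a::euclidean_space \<Rightarrow> real"
  assumes S: "subspace S" and g: "g differentiable_on S" and y: "y \<in> S"
  shows grad_on_in: "grad_on S g y \<in> S"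
    and has_derivative_grad_on:
      "(g has_derivative (\<lambda>h. inner (grad_on S g y) h)) (at y within S)"
proof -
  obtain D where D: "(g has_derivative D) (at y within S)"
    using g y unfolding differentiable_on_def differentiable_def by blast
  have lin: "linear D" using D has_derivative_linear by blast
  obtain z where z: "z \<in> S" "\<And>x. x \<in> S \<Longrightarrow> inner x (adjoint D 1) = inner x z"
    using orthogonal_projection_exists[OF S] by blast
  have Dz: "D x = inner z x" if "x \<in> S" for x
    using z(2)[OF that] adjoint_works[OF lin, of x 1] by (simp add: inner_commute)
  \<comment> \<open>The derivative condition only tests increments inside the subspace.\<close>
  have "(g has_derivative (\<lambda>h. inner z h)) (at y within S)"
    unfolding has_derivative_within
  proof (intro conjI)
    show "bounded_linear (inner z)" by (rule bounded_linear_inner_right)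
    have "((\<lambda>x. (1 / norm (x - y)) *\<^sub>R (g x - (g y + D (x - y)))) \<longlongrightarrow> 0) (at y within S)"
      using D unfolding has_derivative_within by blast
    then show "((\<lambda>x. (1 / norm (x - y)) *\<^sub>R (g x - (g y + inner z (x - y)))) \<longlongrightarrow> 0)
        (at y within S)"
    proof (rule Lim_transform_eventually)
      show "\<forall>\<^sub>F x in at y within S. (1 / norm (x - y)) *\<^sub>R (g x - (g y + D (x - y)))
          = (1 / norm (x - y)) *\<^sub>R (g x - (g y + inner z (x - y)))"
        using Dz subspace_diff[OF S _ y] by (auto simp: eventually_at_filter)
    qed
  qed
  moreover from grad_on_eqI[OF S y z(1) this] have "grad_on S g y = z" .
  ultimately show "grad_on S g y \<in> S"
    "(g has_derivative (\<lambda>h. inner (grad_on S g y) h)) (at y within S)"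
    using z(1) by auto
qed

lemma grad_on_mean_value:
  fixes g :: "'a::euclidean_space \<Rightarrow> real"
  assumes S: "subspace S" and g: "g differentiable_on S" and p: "p \<in> S" and q: "q \<in> S"
  obtains \<xi> where "0 < \<xi>" "\<xi> < 1" "p + \<xi> *\<^sub>R (q - p) \<in> S"
    "g q - g p = inner (grad_on S g (p + \<xi> *\<^sub>R (q - p))) (q - p)"
proof -
  let ?l = "\<lambda>t::real. p + t *\<^sub>R (q - p)"
  have mem: "?l t \<in> S" for t
    using S p q by (simp add: subspace_add subspace_scale subspace_diff)
  have "((\<lambda>t. g (?l t)) has_derivative (\<lambda>t. inner (grad_on S g (?l s)) (t *\<^sub>R (q - p))))
      (at s within {0..1})" for s
  proof -
    have line: "(?l has_derivative (\<lambda>t. t *\<^sub>R (q - p))) (at s within {0..1})"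
      by (auto intro!: derivative_eq_intros)
    have "(g has_derivative (\<lambda>h. inner (grad_on S g (?l s)) h)) (at (?l s) within ?l ` {0..1})"
      using has_derivative_grad_on[OF S g mem]
      by (rule has_derivative_subset) (auto simp: mem)
    from has_derivative_in_compose[OF line this] show ?thesis .
  qed
  then have "\<exists>s\<in>{0<..<1}. g (?l 1) - g (?l 0)
      = inner (grad_on S g (?l s)) ((1 - 0) *\<^sub>R (q - p))"
    by (intro mvt_simple) auto
  then show thesis using that mem by auto
qed

section \<open>Strongly convex potentials composed with a linear map\<close>

lemma strongly_convex_on_le_linearization:
  fixes g :: "'a::euclidean_space \<Rightarrow> real"
  assumes S: "subspace S" and g: "g differentiable_on S" and p: "p \<in> S" and q: "q \<in> S"
    and sc: "strongly_convex_on S m g" and m: "0 \<le> m"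
  shows "g q - g p \<le> inner (grad_on S g q) (q - p)"
    and "inner (grad_on S g p) (q - p) \<le> g q - g p"
proof -
  obtain \<xi> where xi: "0 < \<xi>" "\<xi> < 1" and mem: "p + \<xi> *\<^sub>R (q - p) \<in> S"
    and eq: "g q - g p = inner (grad_on S g (p + \<xi> *\<^sub>R (q - p))) (q - p)"
    using grad_on_mean_value[OF S g p q] by metis
  let ?z = "p + \<xi> *\<^sub>R (q - p)"
  have mono: "0 \<le> inner (grad_on S g u - grad_on S g v) (u - v)" if "u \<in> S" "v \<in> S" for u v
  proof -
    have "0 \<le> m * (norm (u - v))\<^sup>2" using m by simp
    also have "\<dots> \<le> inner (grad_on S g u - grad_on S g v) (u - v)"
      using sc that unfolding strongly_convex_on_def by blast
    finally show ?thesis .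
  qed
  have "?z - p = \<xi> *\<^sub>R (q - p)" by simp
  with mono[OF mem p] have "0 \<le> \<xi> * inner (grad_on S g ?z - grad_on S g p) (q - p)"
    by simp
  then have "0 \<le> inner (grad_on S g ?z - grad_on S g p) (q - p)"
    using xi by (simp add: zero_le_mult_iff)
  then show "inner (grad_on S g p) (q - p) \<le> g q - g p"
    using eq by (simp add: inner_diff_left)
  have "q - ?z = (1 - \<xi>) *\<^sub>R (q - p)" by (simp add: algebra_simps)
  with mono[OF q mem] have "0 \<le> (1 - \<xi>) * inner (grad_on S g q - grad_on S g ?z) (q - p)"
    by simp
  then have "0 \<le> inner (grad_on S g q - grad_on S g ?z) (q - p)"
    using xi by (simp add: zero_le_mult_iff)
  then show "g q - g p \<le> inner (grad_on S g q) (q - p)"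
    using eq by (simp add: inner_diff_left)
qed

text \<open>Bounding the gradient at the mean-value point instead of integrating it along the segment
  gives \<open>K\<close> in place of the usual \<open>K / 2\<close>; the rate is existential, so constants are free.\<close>

lemma smooth_on_with_upper_bound:
  fixes g :: "'a::euclidean_space \<Rightarrow> real"
  assumes S: "subspace S" and g: "g differentiable_on S" and p: "p \<in> S" and q: "q \<in> S"
    and sm: "smooth_on_with S K g" and K: "0 \<le> K"
  shows "g q \<le> g p + inner (grad_on S g p) (q - p) + K * (norm (q - p))\<^sup>2"
proof -
  obtain \<xi> where xi: "0 < \<xi>" "\<xi> < 1" and mem: "p + \<xi> *\<^sub>R (q - p) \<in> S"
    and eq: "g q - g p = inner (grad_on S g (p + \<xi> *\<^sub>R (q - p))) (q - p)"
    using grad_on_mean_value[OF S g p q] by metis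
  let ?z = "p + \<xi> *\<^sub>R (q - p)"
  have "norm (grad_on S g ?z - grad_on S g p) \<le> K * norm (?z - p)"
    using sm mem p unfolding smooth_on_with_def by blast
  also have "norm (?z - p) = \<xi> * norm (q - p)" using xi by simp
  also have "K * (\<xi> * norm (q - p)) \<le> K * norm (q - p)"
    using K xi by (intro mult_left_mono) (auto simp: mult_left_le_one_le)
  finally have "norm (grad_on S g ?z - grad_on S g p) * norm (q - p) \<le> K * (norm (q - p))\<^sup>2"
    by (simp add: power2_eq_square mult_right_mono mult.assoc[symmetric])
  moreover have "inner (grad_on S g ?z - grad_on S g p) (q - p)
      \<le> norm (grad_on S g ?z - grad_on S g p) * norm (q - p)"
    by (rule norm_cauchy_schwarz)
  ultimately show ?thesis using eq by (simp add: inner_diff_left)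
qed

text \<open>The coboundary plays the role of \<open>A\<close>: it may have a kernel, so \<open>g \<circ> A\<close> need not be strongly
  convex. What survives is linear growth of its gradient with the distance to optimality.\<close>

locale strongly_convex_composite =
  fixes S :: "'a::euclidean_space set" and T :: "'b::euclidean_space set"
    and A :: "'a \<Rightarrow> 'b" and g :: "'b \<Rightarrow> real" and m K :: real
  assumes S: "subspace S" and T: "subspace T" and A: "linear_between S T A"
    and g: "g differentiable_on T"
    and m: "0 < m" and sc: "strongly_convex_on T m g"
    and K: "0 \<le> K" and sm: "smooth_on_with T K g"
begin

definition gradient :: "'a \<Rightarrow> 'a" where
  "gradient x = adjoint_on S A (grad_on T g (A x))"

lemma A_in: "x \<in> S \<Longrightarrow> A x \<in> T"
  using A unfolding linear_between_def by blast

lemma A_diff: "x \<in> S \<Longrightarrow> y \<in> S \<Longrightarrow> A (x - y) = A x - A y"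
  using linear_between_extend[OF S A] subspace_diff[OF S] linear_diff by metis

lemma gradient_in: "gradient x \<in> S"
  unfolding gradient_def by (rule adjoint_on_in[OF S A])

lemma inner_gradient: "z \<in> S \<Longrightarrow> inner (gradient x) z = inner (grad_on T g (A x)) (A z)"
  unfolding gradient_def using inner_adjoint_on[OF S A] by (simp add: inner_commute)

lemma A_bounded:
  obtains M where "0 < M" "\<And>x. x \<in> S \<Longrightarrow> norm (A x) \<le> M * norm x"
proof -
  obtain A' where A': "linear A'" "\<And>x. x \<in> S \<Longrightarrow> A' x = A x"
    using linear_between_extend[OF S A] by blast
  obtain M where "0 < M" "\<And>x. norm (A' x) \<le> M * norm x"
    using linear_bounded_pos[OF A'(1)] by blast
  with A'(2) that show thesis by metis
qed

lemma A_bounded_preimages: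
  obtains k where "0 < k" "\<And>x. x \<in> S \<Longrightarrow> \<exists>z\<in>S. A z = A x \<and> norm z \<le> k * norm (A x)"
proof -
  obtain A' where A': "linear A'" "\<And>x. x \<in> S \<Longrightarrow> A' x = A x"
    using linear_between_extend[OF S A] by blast
  obtain R where R: "range R \<subseteq> S" "linear R" "\<forall>v\<in>A' ` S. A' (R v) = v"
    using linear_exists_right_inverse_on[OF A'(1) S] by blast
  obtain k where k: "0 < k" "\<And>x. norm (R x) \<le> k * norm x"
    using linear_bounded_pos[OF R(2)] by blast
  have "\<exists>z\<in>S. A z = A x \<and> norm z \<le> k * norm (A x)" if "x \<in> S" for x
  proof (intro bexI[of _ "R (A x)"] conjI)
    show "R (A x) \<in> S" using R(1) by blast
    with R(3) A'(2) that show "A (R (A x)) = A x" by (metis imageI)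
  qed (rule k(2))
  with k(1) that show thesis by blast
qed

lemma gradient_Lipschitz_and_upper_bound:
  obtains \<Lambda> where "0 \<le> \<Lambda>"
    "\<And>x y. x \<in> S \<Longrightarrow> y \<in> S \<Longrightarrow> norm (gradient x - gradient y) \<le> \<Lambda> * norm (x - y)"
    "\<And>x y. x \<in> S \<Longrightarrow> y \<in> S \<Longrightarrow>
       g (A y) \<le> g (A x) + inner (gradient x) (y - x) + \<Lambda> * (norm (y - x))\<^sup>2"
proof -
  obtain M where M: "0 < M" "\<And>x. x \<in> S \<Longrightarrow> norm (A x) \<le> M * norm x"
    using A_bounded by blast
  have lip: "norm (gradient x - gradient y) \<le> (K * M\<^sup>2) * norm (x - y)"
    if x: "x \<in> S" and y: "y \<in> S" for x y
  proof -
    let ?w = "gradient x - gradient y"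
    have w: "?w \<in> S" using gradient_in S subspace_diff by blast
    have "(norm ?w)\<^sup>2 = inner (gradient x - gradient y) ?w" by (rule power2_norm_eq_inner)
    also have "\<dots> = inner (grad_on T g (A x) - grad_on T g (A y)) (A ?w)"
      by (simp add: inner_diff_left inner_gradient[OF w])
    also have "\<dots> \<le> norm (grad_on T g (A x) - grad_on T g (A y)) * norm (A ?w)"
      by (rule norm_cauchy_schwarz)
    also have "\<dots> \<le> (K * norm (A x - A y)) * (M * norm ?w)"
      using sm A_in[OF x] A_in[OF y] M(2)[OF w] K unfolding smooth_on_with_def
      by (intro mult_mono) auto
    also have "\<dots> \<le> (K * (M * norm (x - y))) * (M * norm ?w)"
      using M(2)[OF subspace_diff[OF S x y]] A_diff[OF x y] K M(1)
      by (intro mult_right_mono mult_left_mono) auto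
    finally have "norm ?w * norm ?w \<le> (K * M\<^sup>2 * norm (x - y)) * norm ?w"
      by (simp add: power2_eq_square mult_ac)
    then show ?thesis
      using K by (cases "norm ?w = 0") auto
  qed
  have "g (A y) \<le> g (A x) + inner (gradient x) (y - x) + (K * M\<^sup>2) * (norm (y - x))\<^sup>2"
    if x: "x \<in> S" and y: "y \<in> S" for x y
  proof -
    have d: "y - x \<in> S" by (rule subspace_diff[OF S y x])
    have "(norm (A (y - x)))\<^sup>2 \<le> (M * norm (y - x))\<^sup>2"
      using M(2)[OF d] by (intro power_mono) auto
    then have "K * (norm (A (y - x)))\<^sup>2 \<le> (K * M\<^sup>2) * (norm (y - x))\<^sup>2"
      using K by (simp add: power_mult_distrib mult.assoc mult_left_mono)
    with smooth_on_with_upper_bound[OF T g A_in[OF x] A_in[OF y] sm K]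
    show ?thesis by (simp add: inner_gradient[OF d] A_diff[OF y x])
  qed
  with lip K that[of "K * M\<^sup>2"] show thesis by simp
qed

lemma stationary_imp_minimizer:
  assumes x: "x \<in> S" and y: "y \<in> S" and crit: "gradient y = 0"
  shows "g (A y) \<le> g (A x)"
proof -
  have "inner (grad_on T g (A y)) (A x - A y) = inner (gradient y) (x - y)"
    using inner_gradient[OF subspace_diff[OF S x y]] A_diff[OF x y] by simp
  with strongly_convex_on_le_linearization(2)[OF T g A_in[OF y] A_in[OF x] sc less_imp_le[OF m]]
  show ?thesis by (simp add: crit)
qed

text \<open>A Polyak--Lojasiewicz inequality. The displacement \<open>A x - A y\<close> is lifted to a vector \<open>z\<close> of
  comparable size, so that pairing \<open>gradient x\<close> with \<open>z\<close> bounds both the energy gap (by convexity)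
  and \<open>m * (norm (A x - A y))\<^sup>2\<close> (by strong monotonicity); the second bound turns the first one
  into a multiple of the squared gradient.\<close>

lemma gap_le_gradient_squared:
  assumes y: "y \<in> S" and crit: "gradient y = 0"
  obtains P where "0 \<le> P" "\<And>x. x \<in> S \<Longrightarrow> g (A x) - g (A y) \<le> P * (norm (gradient x))\<^sup>2"
proof -
  obtain k where k: "0 < k" "\<And>x. x \<in> S \<Longrightarrow> \<exists>z\<in>S. A z = A x \<and> norm z \<le> k * norm (A x)"
    using A_bounded_preimages by blast
  have "g (A x) - g (A y) \<le> (k\<^sup>2 / m) * (norm (gradient x))\<^sup>2" if x: "x \<in> S" for x
  proof -
    let ?G = "norm (gradient x)" and ?r = "norm (A x - A y)"
    obtain z where z: "z \<in> S" "A z = A x - A y" "norm z \<le> k * ?r"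
      using k(2)[OF subspace_diff[OF S x y]] A_diff[OF x y] by auto
    have "inner (gradient x) z \<le> ?G * norm z" by (rule norm_cauchy_schwarz)
    also have "\<dots> \<le> ?G * (k * ?r)" using z(3) by (intro mult_left_mono) auto
    finally have up: "inner (gradient x) z \<le> ?G * (k * ?r)" .
    have gap: "g (A x) - g (A y) \<le> inner (gradient x) z"
      using strongly_convex_on_le_linearization(1)[OF T g A_in[OF y] A_in[OF x] sc less_imp_le[OF m]]
      by (simp add: inner_gradient[OF z(1)] z(2))
    have "m * ?r\<^sup>2 \<le> inner (grad_on T g (A x) - grad_on T g (A y)) (A z)"
      using sc A_in[OF x] A_in[OF y] unfolding strongly_convex_on_def z(2) by blast
    also have "\<dots> = inner (gradient x) z"
      by (simp add: inner_diff_left flip: inner_gradient[OF z(1)]) (simp add: crit)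
    finally have "m * ?r\<^sup>2 \<le> ?G * (k * ?r)" using up by simp
    then have "?r * (m * ?r) \<le> ?r * (k * ?G)" by (simp add: power2_eq_square mult_ac)
    then have "m * ?r \<le> k * ?G"
      using k(1) by (cases "?r = 0") auto
    then have "?r \<le> k * ?G / m" using m by (simp add: field_simps)
    then have "?G * (k * ?r) \<le> ?G * (k * (k * ?G / m))"
      using k(1) by (intro mult_left_mono) auto
    also have "\<dots> = (k\<^sup>2 / m) * ?G\<^sup>2" by (simp add: power2_eq_square)
    finally show ?thesis using gap up by linarith
  qed
  with m that[of "k\<^sup>2 / m"] show thesis by simp
qed

end

section \<open>Gradient descent with bounded delays\<close>

lemma norm_squared_vec: "(norm (v :: 'a::real_normed_vector ^ 'n::finite))\<^sup>2 = (\<Sum>i\<in>UNIV. (norm (v $ i))\<^sup>2)"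
  by (simp add: norm_vec_def L2_set_def sum_nonneg)

lemma norm_diff_squared_le_increments:
  fixes y :: "int \<Rightarrow> 'a::real_normed_vector"
  assumes "lo \<le> u" "u \<le> hi" "lo \<le> t" "t \<le> hi"
  shows "(norm (y t - y u))\<^sup>2 \<le> real_of_int (hi - lo) * (\<Sum>s\<in>{lo..<hi}. (norm (y (s + 1) - y s))\<^sup>2)"
proof -
  have tele: "(\<Sum>s\<in>{a..<b}. y (s + 1) - y s) = y b - y a" if "a \<le> b" for a b
    using that
  proof (induction b rule: int_ge_induct)
    case (step i)
    then have "{a..<i + 1} = insert i {a..<i}" by auto
    with step show ?case by simp
  qed simp
  have path: "norm (y b - y a) \<le> (\<Sum>s\<in>{lo..<hi}. norm (y (s + 1) - y s))"
    if "lo \<le> a" "a \<le> b" "b \<le> hi" for a b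
  proof -
    have "norm (y b - y a) \<le> (\<Sum>s\<in>{a..<b}. norm (y (s + 1) - y s))"
      unfolding tele[OF that(2), symmetric] by (rule norm_sum)
    also have "\<dots> \<le> (\<Sum>s\<in>{lo..<hi}. norm (y (s + 1) - y s))"
      using that by (intro sum_mono2) auto
    finally show ?thesis .
  qed
  have "norm (y t - y u) \<le> (\<Sum>s\<in>{lo..<hi}. norm (y (s + 1) - y s))"
    using path[of t u] path[of u t] assms by (cases "u \<le> t") (auto simp: norm_minus_commute)
  then have "(norm (y t - y u))\<^sup>2 \<le> (\<Sum>s\<in>{lo..<hi}. norm (y (s + 1) - y s))\<^sup>2"
    by (intro power_mono) auto
  also have "\<dots> \<le> (\<Sum>s\<in>{lo..<hi}. (norm (y (s + 1) - y s))\<^sup>2) * card {lo..<hi}"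
    by (rule sum_squared_le_sum_of_squares)
  finally show ?thesis using assms by (simp add: mult.commute)
qed

text \<open>A delayed view mixes coordinates of different dates. Its error is controlled by the squared
  increments over the dates involved, with no factor for the number of coordinates.\<close>

lemma delayed_view_error:
  fixes x :: "int \<Rightarrow> 'a::real_normed_vector ^ 'n::finite"
  assumes "lo \<le> t" "t \<le> hi" and z: "\<And>j. \<exists>u. lo \<le> u \<and> u \<le> hi \<and> z $ j = x u $ j"
  shows "(norm (x t - z))\<^sup>2 \<le> real_of_int (hi - lo) * (\<Sum>s\<in>{lo..<hi}. (norm (x (s + 1) - x s))\<^sup>2)"
proof -
  have "(norm ((x t - z) $ j))\<^sup>2
      \<le> real_of_int (hi - lo) * (\<Sum>s\<in>{lo..<hi}. (norm ((x (s + 1) - x s) $ j))\<^sup>2)" for j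
  proof -
    obtain u where "lo \<le> u" "u \<le> hi" "z $ j = x u $ j" using z by blast
    with norm_diff_squared_le_increments[of lo u hi t "\<lambda>s. x s $ j"] assms(1,2)
    show ?thesis by simp
  qed
  then have "(norm (x t - z))\<^sup>2 \<le> (\<Sum>j\<in>UNIV. real_of_int (hi - lo) *
      (\<Sum>s\<in>{lo..<hi}. (norm ((x (s + 1) - x s) $ j))\<^sup>2))"
    unfolding norm_squared_vec[of "x t - z"] by (intro sum_mono) auto
  also have "\<dots> = real_of_int (hi - lo) * (\<Sum>s\<in>{lo..<hi}. (norm (x (s + 1) - x s))\<^sup>2)"
    unfolding norm_squared_vec[of "x (_ + 1) - x _"] sum_distrib_left[symmetric]
    by (subst sum.swap) simp
  finally show ?thesis .
qed

text \<open>Elimination of \<open>\<beta>'\<close> between the two window estimates. The weight \<open>2 * D\<close> on the variation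
  leaves the positive multiple \<open>1 / \<gamma> - 3 * D\<close> of \<open>\<beta>'\<close> in the descent estimate; bounding \<open>\<beta>'\<close> from
  below by the second estimate converts it into a decrease proportional to \<open>\<alpha>\<close>.\<close>

lemma lyapunov_contraction:
  fixes \<alpha> \<alpha>' \<beta> \<beta>' \<gamma> D E :: real
  defines "\<theta> \<equiv> (1 / \<gamma> - 3 * D) / (E / \<gamma>\<^sup>2 + E)"
  assumes \<gamma>: "0 < \<gamma>" "\<gamma> < 1 / (4 * D)" and D: "1 \<le> D" and E: "1 \<le> E"
  shows "0 < \<theta>" "\<theta> < 1"
    and "\<lbrakk>0 \<le> \<alpha>; 0 \<le> \<beta>; \<alpha>' \<le> \<alpha> - (1 / \<gamma> - D) * \<beta>' + D * \<beta>; \<alpha> \<le> E / \<gamma>\<^sup>2 * \<beta>' + E * (\<beta> + \<beta>')\<rbrakk>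
      \<Longrightarrow> \<alpha>' + 2 * D * \<beta>' \<le> (1 - \<theta>) * (\<alpha> + 2 * D * \<beta>)"
proof -
  let ?q = "1 / \<gamma> - 3 * D" and ?M = "E / \<gamma>\<^sup>2 + E"
  have "4 * D < 1 / \<gamma>" using \<gamma> D by (simp add: field_simps)
  then have q: "0 < ?q" using D by linarith
  have M: "0 < ?M" using \<gamma> E by (simp add: add_pos_pos)
  show pos: "0 < \<theta>" unfolding \<theta>_def using q M by simp
  have "?q \<le> 1 / \<gamma>" using D by simp
  also have "\<dots> = \<gamma> * (1 / \<gamma>\<^sup>2)" using \<gamma> by (simp add: power2_eq_square)
  also have "\<dots> \<le> \<gamma> * (1 / \<gamma>\<^sup>2 + 1)" using \<gamma> by (intro mult_left_mono) auto
  finally have "E * ?q \<le> E * (\<gamma> * (1 / \<gamma>\<^sup>2 + 1))" using E by (intro mult_left_mono) auto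
  also have "\<dots> = \<gamma> * ?M" by (simp add: algebra_simps)
  finally have "\<theta> * E \<le> \<gamma>" unfolding \<theta>_def using M by (simp add: pos_divide_le_eq mult.commute)
  moreover have "\<gamma> < 1 / 4"
  proof -
    have "1 / (4 * D) \<le> 1 / 4" using D by (simp add: field_simps)
    with \<gamma> show ?thesis by linarith
  qed
  ultimately have thE: "\<theta> * E < 1 / 4" by simp
  moreover have "\<theta> * 1 \<le> \<theta> * E" using pos E by (intro mult_left_mono) auto
  ultimately have th: "\<theta> < 1 / 4" by simp
  then show "\<theta> < 1" by simp
  assume \<alpha>: "0 \<le> \<alpha>" and \<beta>: "0 \<le> \<beta>" and desc: "\<alpha>' \<le> \<alpha> - (1 / \<gamma> - D) * \<beta>' + D * \<beta>"
    and lower: "\<alpha> \<le> E / \<gamma>\<^sup>2 * \<beta>' + E * (\<beta> + \<beta>')"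
  have "\<alpha> - E * \<beta> \<le> ?M * \<beta>'" using lower by (simp add: algebra_simps)
  then have "\<theta> * (\<alpha> - E * \<beta>) \<le> \<theta> * (?M * \<beta>')" using pos by (intro mult_left_mono) auto
  also have "\<dots> = ?q * \<beta>'" unfolding \<theta>_def using M by simp
  finally have "\<alpha>' + 2 * D * \<beta>' \<le> (1 - \<theta>) * \<alpha> + (\<theta> * E + D) * \<beta>"
    using desc by (simp add: algebra_simps)
  also have "\<theta> * E + D \<le> (1 - \<theta>) * (2 * D)"
  proof -
    have "\<theta> * (2 * D) \<le> 1 / 4 * (2 * D)" using th D by (intro mult_right_mono) auto
    then have "3 / 2 * D \<le> (1 - \<theta>) * (2 * D)" by (simp add: left_diff_distrib)
    with thE D show ?thesis by linarith
  qed
  finally show "\<alpha>' + 2 * D * \<beta>' \<le> (1 - \<theta>) * (\<alpha> + 2 * D * \<beta>)"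
    using \<beta> by (simp add: algebra_simps mult_right_mono)
qed

text \<open>Here \<open>h\<close> is the gap to the minimum, and the vector \<open>z\<close> in the update rule is the delayed view on
  which a coordinate acts.\<close>

locale partially_asynchronous_descent =
  fixes S :: "('a::euclidean_space ^ 'v::finite) set"
    and h :: "'a ^ 'v \<Rightarrow> real" and G :: "'a ^ 'v \<Rightarrow> 'a ^ 'v"
    and \<Lambda> P :: real and B :: nat and T :: "'v \<Rightarrow> nat set" and \<gamma> :: real and x :: "int \<Rightarrow> 'a ^ 'v"
  assumes in_S: "x t \<in> S"
    and h_nonneg: "v \<in> S \<Longrightarrow> 0 \<le> h v"
    and \<Lambda>: "0 \<le> \<Lambda>"
    and Lipschitz: "\<lbrakk>v \<in> S; w \<in> S\<rbrakk> \<Longrightarrow> norm (G v - G w) \<le> \<Lambda> * norm (v - w)"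
    and upper_bound: "\<lbrakk>v \<in> S; w \<in> S\<rbrakk> \<Longrightarrow> h w \<le> h v + inner (G v) (w - v) + \<Lambda> * (norm (w - v))\<^sup>2"
    and P: "0 \<le> P"
    and gap_bound: "v \<in> S \<Longrightarrow> h v \<le> P * (norm (G v))\<^sup>2"
    and \<gamma>: "0 < \<gamma>"
    and active: "{k..k + B} \<inter> T i \<noteq> {}"
    and update: "k \<in> T i \<Longrightarrow> \<exists>z\<in>S. (\<forall>j. \<exists>u. int k - int B \<le> u \<and> u \<le> int k \<and> z $ j = x u $ j)
        \<and> x (int k + 1) $ i = x (int k) $ i - \<gamma> *\<^sub>R (G z $ i)"
    and idle: "k \<notin> T i \<Longrightarrow> x (int k + 1) $ i = x (int k) $ i"
begin

abbreviation sq_step :: "int \<Rightarrow> real" where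
  "sq_step s \<equiv> (norm (x (s + 1) - x s))\<^sup>2"

lemma gradient_error:
  assumes "lo \<le> t" "t \<le> hi" "z \<in> S" "\<And>j. \<exists>u. lo \<le> u \<and> u \<le> hi \<and> z $ j = x u $ j"
  shows "(norm (G (x t) - G z))\<^sup>2 \<le> \<Lambda>\<^sup>2 * (real_of_int (hi - lo) * (\<Sum>s\<in>{lo..<hi}. sq_step s))"
proof -
  have "(norm (G (x t) - G z))\<^sup>2 \<le> (\<Lambda> * norm (x t - z))\<^sup>2"
    using Lipschitz[OF in_S assms(3)] by (intro power_mono) auto
  also have "\<dots> \<le> \<Lambda>\<^sup>2 * (real_of_int (hi - lo) * (\<Sum>s\<in>{lo..<hi}. sq_step s))"
    unfolding power_mult_distrib
    using delayed_view_error[of lo t hi z x] assms by (intro mult_left_mono) auto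
  finally show ?thesis .
qed

text \<open>An active coordinate moves along its gradient at a delayed view. Replacing that gradient by
  the current one costs, by Young's inequality, half the squared step and half the squared gradient
  error; against the decrease \<open>1 / \<gamma>\<close> times the squared step both are affordable for small \<open>\<gamma>\<close>.\<close>

lemma energy_one_step:
  "h (x (int k + 1)) \<le> h (x (int k)) - (1 / \<gamma> - 1 / 2 - \<Lambda>) * sq_step (int k)
     + CARD('v) * \<Lambda>\<^sup>2 * B / 2 * (\<Sum>s\<in>{int k - int B..<int k}. sq_step s)"
proof -
  let ?s = "x (int k + 1) - x (int k)" and ?Q = "\<Sum>s\<in>{int k - int B..<int k}. sq_step s"
  have coord: "inner (G (x (int k)) $ i) (?s $ i)
      \<le> - (1 / \<gamma> - 1 / 2) * (norm (?s $ i))\<^sup>2 + \<Lambda>\<^sup>2 * B * ?Q / 2" for i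
  proof (cases "k \<in> T i")
    case False
    have "0 \<le> ?Q" by (intro sum_nonneg) auto
    with idle[OF False] show ?thesis by simp
  next
    case True
    obtain z where z: "z \<in> S" "\<And>j. \<exists>u. int k - int B \<le> u \<and> u \<le> int k \<and> z $ j = x u $ j"
      and up: "x (int k + 1) $ i = x (int k) $ i - \<gamma> *\<^sub>R (G z $ i)"
      using update[OF True] by blast
    let ?e = "(G (x (int k)) - G z) $ i"
    have "?s $ i = - \<gamma> *\<^sub>R (G z $ i)" using up by simp
    then have "G z $ i = - (1 / \<gamma>) *\<^sub>R (?s $ i)" using \<gamma> by simp
    then have "inner (G z $ i) (?s $ i) = - (1 / \<gamma>) * (norm (?s $ i))\<^sup>2"
      unfolding power2_norm_eq_inner by (metis inner_scaleR_left)
    then have "inner (G (x (int k)) $ i) (?s $ i) = - (1 / \<gamma>) * (norm (?s $ i))\<^sup>2 + inner ?e (?s $ i)"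
      by (simp add: inner_diff_left del: vector_minus_component add: vector_minus_component[of "G _"])
    moreover have "2 * inner ?e (?s $ i) \<le> (norm ?e)\<^sup>2 + (norm (?s $ i))\<^sup>2"
    proof -
      have "0 \<le> (norm (?e - ?s $ i))\<^sup>2" by simp
      then show ?thesis
        unfolding power2_norm_eq_inner by (simp add: inner_diff inner_commute)
    qed
    moreover have "(norm ?e)\<^sup>2 \<le> \<Lambda>\<^sup>2 * B * ?Q"
    proof -
      have "(norm ?e)\<^sup>2 \<le> (norm (G (x (int k)) - G z))\<^sup>2"
        by (intro power_mono Finite_Cartesian_Product.norm_nth_le norm_ge_zero)
      also have "\<dots> \<le> \<Lambda>\<^sup>2 * (real_of_int (int k - (int k - int B)) * ?Q)"
        by (rule gradient_error) (use z in auto)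
      finally show ?thesis by (simp add: mult.assoc)
    qed
    ultimately show ?thesis by (simp add: algebra_simps)
  qed
  have "inner (G (x (int k))) ?s
      \<le> (\<Sum>i\<in>UNIV. - (1 / \<gamma> - 1 / 2) * (norm (?s $ i))\<^sup>2 + \<Lambda>\<^sup>2 * B * ?Q / 2)"
    unfolding inner_vec_def[of "G (x (int k))"] by (rule sum_mono) (rule coord)
  also have "\<dots> = - (1 / \<gamma> - 1 / 2) * sq_step (int k) + CARD('v) * (\<Lambda>\<^sup>2 * B * ?Q / 2)"
    unfolding sum.distrib norm_squared_vec[of ?s] by (simp add: sum_distrib_left)
  finally show ?thesis
    using upper_bound[OF in_S[of "int k"] in_S[of "int k + 1"]] by (simp add: algebra_simps)
qed

lemma two_windows:
  "(\<Sum>s\<in>{int k - int B - 1..<int k + int B + 1}. sq_step s)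
     = recent_variation B x (int k) + recent_variation B x (int k + int B + 1)"
proof -
  have "{int k - int B - 1..int k - 1} \<union> {int k..int k + int B}
      = {int k - int B - 1..<int k + int B + 1}" by auto
  moreover have "{int k - int B - 1..int k - 1} \<inter> {int k..int k + int B} = {}" by auto
  ultimately show ?thesis
    unfolding recent_variation_def by (simp flip: sum.union_disjoint)
qed

text \<open>Delays reach back at most one window, so summing over a window counts each increment of this
  window and the preceding one at most \<open>B + 1\<close> times.\<close>

lemma energy_one_window:
  fixes D :: real
  assumes D: "1 + \<Lambda> + CARD('v) * \<Lambda>\<^sup>2 * (real B + 1)\<^sup>2 \<le> D"
  shows "h (x (int k + int B + 1)) \<le> h (x (int k))
    - (1 / \<gamma> - D) * recent_variation B x (int k + int B + 1) + D * recent_variation B x (int k)"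
proof -
  define R where "R = (\<Sum>s\<in>{int k - int B - 1..<int k + int B + 1}. sq_step s)"
  define C where "C = CARD('v) * \<Lambda>\<^sup>2 * (real B + 1)\<^sup>2"
  have C: "0 \<le> C" "1 + \<Lambda> + C \<le> D" using D unfolding C_def by auto
  let ?q = "CARD('v) * \<Lambda>\<^sup>2 * B / 2" and ?\<beta> = "recent_variation B x (int k)"
    and ?\<beta>' = "recent_variation B x (int k + int B + 1)"
  have nn: "0 \<le> ?\<beta>" "0 \<le> ?\<beta>'" unfolding recent_variation_def by (auto intro: sum_nonneg)
  have R: "R = ?\<beta> + ?\<beta>'" unfolding R_def by (rule two_windows)
  have "h (x (int k + int n)) \<le> h (x (int k))
      - (1 / \<gamma> - 1 / 2 - \<Lambda>) * (\<Sum>s\<in>{int k..<int k + int n}. sq_step s) + n * (?q * R)"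
    if "n \<le> B + 1" for n
    using that
  proof (induction n)
    case (Suc n)
    have "(\<Sum>s\<in>{int (k + n) - int B..<int (k + n)}. sq_step s) \<le> R"
      unfolding R_def by (rule sum_mono2) (use Suc in auto)
    then have "?q * (\<Sum>s\<in>{int (k + n) - int B..<int (k + n)}. sq_step s) \<le> ?q * R"
      by (intro mult_left_mono) auto
    with energy_one_step[of "k + n"]
    have "h (x (int k + int (Suc n))) \<le> h (x (int k + int n))
      - (1 / \<gamma> - 1 / 2 - \<Lambda>) * sq_step (int k + int n) + ?q * R"
      unfolding of_nat_add of_nat_Suc by (simp only: add_ac)
    with Suc have "h (x (int k + int (Suc n))) \<le> h (x (int k))
      - (1 / \<gamma> - 1 / 2 - \<Lambda>) * (\<Sum>s\<in>{int k..<int k + int n}. sq_step s) + n * (?q * R)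
      - (1 / \<gamma> - 1 / 2 - \<Lambda>) * sq_step (int k + int n) + ?q * R"
      by linarith
    moreover have "{int k..<int k + int (Suc n)} = insert (int k + int n) {int k..<int k + int n}"
      by auto
    ultimately show ?case by (simp add: algebra_simps add_divide_distrib)
  qed simp
  from this[of "B + 1"] have "h (x (int k + int B + 1)) \<le> h (x (int k))
      - (1 / \<gamma> - 1 / 2 - \<Lambda>) * (\<Sum>s\<in>{int k..<int k + int B + 1}. sq_step s) + (real B + 1) * (?q * R)"
    by (simp add: add_ac)
  moreover have "(\<Sum>s\<in>{int k..<int k + int B + 1}. sq_step s) = ?\<beta>'"
    unfolding recent_variation_def by (intro sum.cong) auto
  moreover have "(real B + 1) * (?q * R) \<le> C * R"
  proof -
    have "(real B + 1) * (real B / 2) \<le> (real B + 1) * (real B + 1)"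
      by (intro mult_left_mono) auto
    then have "(CARD('v) * \<Lambda>\<^sup>2) * ((real B + 1) * (real B / 2)) * R
        \<le> (CARD('v) * \<Lambda>\<^sup>2) * ((real B + 1) * (real B + 1)) * R"
      using nn R by (intro mult_right_mono mult_left_mono) auto
    then show ?thesis unfolding C_def by (simp add: power2_eq_square mult_ac)
  qed
  ultimately have "h (x (int k + int B + 1))
      \<le> h (x (int k)) - (1 / \<gamma> - 1 / 2 - \<Lambda>) * ?\<beta>' + C * (?\<beta> + ?\<beta>')"
    unfolding R by simp
  moreover have "C * ?\<beta> \<le> D * ?\<beta>"
    using C \<Lambda> nn by (intro mult_right_mono) auto
  moreover have "(1 / 2 + \<Lambda> + C) * ?\<beta>' \<le> D * ?\<beta>'"
    using C nn by (intro mult_right_mono) auto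
  ultimately show ?thesis by (simp add: algebra_simps)
qed

text \<open>Every coordinate acts once per window, and its step then reveals its partial gradient, up to
  drift within two windows. Hence a small variation forces a small gradient, and so a small gap.\<close>

lemma gap_le_variation:
  fixes E :: real
  assumes E: "P * CARD('v) * (2 + 4 * \<Lambda>\<^sup>2 * (real B + 1)) \<le> E"
  shows "h (x (int k)) \<le> E / \<gamma>\<^sup>2 * recent_variation B x (int k + int B + 1)
    + E * (recent_variation B x (int k) + recent_variation B x (int k + int B + 1))"
proof -
  define R where "R = (\<Sum>s\<in>{int k - int B - 1..<int k + int B + 1}. sq_step s)"
  let ?\<beta> = "recent_variation B x (int k)" and ?\<beta>' = "recent_variation B x (int k + int B + 1)"
  have nn: "0 \<le> ?\<beta>" "0 \<le> ?\<beta>'" unfolding recent_variation_def by (auto intro: sum_nonneg)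
  have R: "R = ?\<beta> + ?\<beta>'" unfolding R_def by (rule two_windows)
  have coord: "(norm (G (x (int k)) $ i))\<^sup>2 \<le> 2 / \<gamma>\<^sup>2 * ?\<beta>' + 4 * \<Lambda>\<^sup>2 * (real B + 1) * R" for i
  proof -
    obtain l where l: "k \<le> l" "l \<le> k + B" "l \<in> T i" using active[of k i] by auto
    obtain z where z: "z \<in> S" "\<And>j. \<exists>u. int l - int B \<le> u \<and> u \<le> int l \<and> z $ j = x u $ j"
      and up: "x (int l + 1) $ i = x (int l) $ i - \<gamma> *\<^sub>R (G z $ i)"
      using update[OF l(3)] by blast
    let ?e = "(G (x (int k)) - G z) $ i" and ?s = "x (int l + 1) - x (int l)"
    have "?s $ i = - \<gamma> *\<^sub>R (G z $ i)" using up by simp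
    then have Gz: "norm (G z $ i) = norm (?s $ i) / \<gamma>" using \<gamma> by simp
    have "norm (G (x (int k)) $ i) \<le> norm (G z $ i) + norm ?e"
      using norm_triangle_ineq[of "G z $ i" ?e] by simp
    then have "(norm (G (x (int k)) $ i))\<^sup>2 \<le> (norm (G z $ i) + norm ?e)\<^sup>2"
      by (intro power_mono) auto
    also have "\<dots> \<le> 2 * (norm (G z $ i))\<^sup>2 + 2 * (norm ?e)\<^sup>2"
      using sum_squares_bound[of "norm (G z $ i)" "norm ?e"] by (simp add: power2_sum)
    also have "(norm ?e)\<^sup>2 \<le> \<Lambda>\<^sup>2 * (2 * (real B + 1) * R)"
    proof -
      have "(norm ?e)\<^sup>2 \<le> (norm (G (x (int k)) - G z))\<^sup>2"
        by (intro power_mono Finite_Cartesian_Product.norm_nth_le norm_ge_zero)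
      also have "\<dots> \<le> \<Lambda>\<^sup>2 * (real_of_int ((int k + int B + 1) - (int k - int B - 1)) * R)"
        unfolding R_def
      proof (rule gradient_error)
        show "\<exists>u. int k - int B - 1 \<le> u \<and> u \<le> int k + int B + 1 \<and> z $ j = x u $ j" for j
        proof -
          obtain u where "int l - int B \<le> u" "u \<le> int l" "z $ j = x u $ j" using z(2) by blast
          with l(1,2) show ?thesis by (intro exI[of _ u]) auto
        qed
      qed (use z(1) in auto)
      finally show ?thesis by simp
    qed
    also have "(norm (G z $ i))\<^sup>2 \<le> ?\<beta>' / \<gamma>\<^sup>2"
    proof -
      have "(norm (?s $ i))\<^sup>2 \<le> sq_step (int l)" by (intro power_mono Finite_Cartesian_Product.norm_nth_le norm_ge_zero)
      also have "\<dots> \<le> ?\<beta>'"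
        unfolding recent_variation_def by (rule member_le_sum) (use l in auto)
      finally show ?thesis unfolding Gz power_divide by (intro divide_right_mono) auto
    qed
    finally show ?thesis by (simp add: algebra_simps)
  qed
  have "(norm (G (x (int k))))\<^sup>2 \<le> (\<Sum>i\<in>(UNIV::'v set). 2 / \<gamma>\<^sup>2 * ?\<beta>' + 4 * \<Lambda>\<^sup>2 * (real B + 1) * R)"
    unfolding norm_squared_vec[of "G (x (int k))"] by (rule sum_mono) (rule coord)
  then have "P * (norm (G (x (int k))))\<^sup>2
      \<le> P * (CARD('v) * (2 / \<gamma>\<^sup>2 * ?\<beta>' + 4 * \<Lambda>\<^sup>2 * (real B + 1) * R))"
    using P by (intro mult_left_mono) auto
  with gap_bound[OF in_S[of "int k"]]
  have "h (x (int k)) \<le> (P * CARD('v) * 2) * (?\<beta>' / \<gamma>\<^sup>2) + (P * CARD('v) * (4 * \<Lambda>\<^sup>2 * (real B + 1))) * R"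
    by (simp add: algebra_simps)
  also have "\<dots> \<le> E * (?\<beta>' / \<gamma>\<^sup>2) + E * R"
  proof -
    have "0 \<le> P * CARD('v) * 2" "0 \<le> P * CARD('v) * (4 * \<Lambda>\<^sup>2 * (real B + 1))"
      using P by auto
    then have "P * CARD('v) * 2 \<le> E" "P * CARD('v) * (4 * \<Lambda>\<^sup>2 * (real B + 1)) \<le> E"
      using E unfolding distrib_left by linarith+
    with nn R show ?thesis by (intro add_mono mult_right_mono) auto
  qed
  finally show ?thesis unfolding R by simp
qed

lemma linear_convergence:
  assumes step_size: "\<gamma> < 1 / (4 * (1 + \<Lambda> + CARD('v) * \<Lambda>\<^sup>2 * (real B + 1)\<^sup>2))"
  shows "\<exists>a b c. a > 0 \<and> b > 0 \<and> c > 0 \<and> c < 1 / \<gamma> \<and>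
    (\<forall>r::nat. h (x (int (r * (B + 1)))) \<le> a * (1 - \<gamma> * c) ^ r
      \<and> recent_variation B x (int (r * (B + 1))) \<le> b * (1 - \<gamma> * c) ^ r)"
proof -
  define D where "D = 1 + \<Lambda> + CARD('v) * \<Lambda>\<^sup>2 * (real B + 1)\<^sup>2"
  define E where "E = 1 + P * CARD('v) * (2 + 4 * \<Lambda>\<^sup>2 * (real B + 1))"
  define \<theta> where "\<theta> = (1 / \<gamma> - 3 * D) / (E / \<gamma>\<^sup>2 + E)"
  have D: "1 \<le> D" unfolding D_def using \<Lambda> by simp
  have E: "1 \<le> E" unfolding E_def using P by simp
  have small: "\<gamma> < 1 / (4 * D)" using step_size unfolding D_def .
  note contract = lyapunov_contraction[OF \<gamma> small D E, folded \<theta>_def]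
  define \<Phi> where "\<Phi> k = h (x (int k)) + 2 * D * recent_variation B x (int k)" for k
  have var: "0 \<le> recent_variation B x t" for t
    unfolding recent_variation_def by (auto intro: sum_nonneg)
  have "\<Phi> (k + (B + 1)) \<le> (1 - \<theta>) * \<Phi> k" for k
  proof -
    have next_window: "int (k + (B + 1)) = int k + int B + 1" by simp
    show ?thesis
      unfolding \<Phi>_def next_window
      by (rule contract(3)[OF h_nonneg[OF in_S] var energy_one_window gap_le_variation])
        (simp_all add: D_def E_def)
  qed
  note step = this
  have rate: "\<Phi> (r * (B + 1)) \<le> \<Phi> 0 * (1 - \<theta>) ^ r" for r
  proof (induction r)
    case (Suc r)
    have "\<Phi> (Suc r * (B + 1)) \<le> (1 - \<theta>) * \<Phi> (r * (B + 1))"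
      using step[of "r * (B + 1)"] by (simp add: add_ac)
    also have "\<dots> \<le> (1 - \<theta>) * (\<Phi> 0 * (1 - \<theta>) ^ r)"
      using Suc contract(2) by (intro mult_left_mono) auto
    finally show ?case by (simp add: mult_ac)
  qed simp
  \<comment> \<open>The extra \<open>1\<close> keeps the constants positive when the run starts at rest at a minimizer.\<close>
  define a where "a = \<Phi> 0 + 1"
  have \<Phi>0: "0 \<le> \<Phi> 0" unfolding \<Phi>_def using h_nonneg[OF in_S] var D by simp
  have pow: "0 \<le> (1 - \<theta>) ^ r" for r using contract(2) by simp
  have bound: "\<Phi> (r * (B + 1)) \<le> a * (1 - \<theta>) ^ r" for r
    using rate[of r] pow[of r] unfolding a_def distrib_right by linarith
  have "h (x (int (r * (B + 1)))) \<le> a * (1 - \<gamma> * (\<theta> / \<gamma>)) ^ r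
      \<and> recent_variation B x (int (r * (B + 1))) \<le> a * (1 - \<gamma> * (\<theta> / \<gamma>)) ^ r" for r
  proof -
    let ?v = "recent_variation B x (int (r * (B + 1)))"
    have "h (x (int (r * (B + 1)))) \<le> \<Phi> (r * (B + 1))"
      unfolding \<Phi>_def using var D by simp
    moreover have "1 * ?v \<le> 2 * D * ?v" using var D by (intro mult_right_mono) auto
    then have "?v \<le> \<Phi> (r * (B + 1))"
      unfolding \<Phi>_def using h_nonneg[OF in_S[of "int (r * (B + 1))"]] by linarith
    ultimately show ?thesis using bound[of r] \<gamma> by simp
  qed
  moreover have "\<theta> / \<gamma> < 1 / \<gamma>" "0 < \<theta> / \<gamma>" "0 < a"
    using contract(1,2) \<gamma> \<Phi>0 unfolding a_def by (auto intro: divide_strict_right_mono)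
  ultimately show ?thesis by blast
qed

end

section \<open>The nonlinear sheaf Laplacian\<close>

context
  fixes F :: "('v::finite, 'a::euclidean_space, 'b::euclidean_space) cellular_sheaf"
    and U :: "'v set \<Rightarrow> 'b \<Rightarrow> real"
  assumes coord: "coordination_sheaf F U"
begin

lemma sheaf: "is_cellular_sheaf F"
  using coord unfolding coordination_sheaf_def by blast

lemma edge_endpoints:
  assumes "e \<in> edges F"
  obtains i j where "orient F e = (i, j)" "e = {i, j}"
proof
  show "orient F e = (fst (orient F e), snd (orient F e))" by simp
  show "e = {fst (orient F e), snd (orient F e)}"
    using sheaf assms unfolding is_cellular_sheaf_def by blast
qed

lemma subspace_node_stalk: "subspace (node_stalk F i)"
  using sheaf unfolding is_cellular_sheaf_def by blast

lemma subspace_edge_stalk: "e \<in> edges F \<Longrightarrow> subspace (edge_stalk F e)"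
  using sheaf unfolding is_cellular_sheaf_def by blast

lemma linear_between_restr:
  assumes e: "e \<in> edges F" and i: "i \<in> e"
  shows "linear_between (node_stalk F i) (edge_stalk F e) (restr F i e)"
proof -
  obtain a b where "e = {a, b}" using edge_endpoints[OF e] .
  with i obtain j where j: "e = {i, j}" by auto
  with e have "j \<in> nbrs F i" unfolding nbrs_def by simp
  then show ?thesis
    using sheaf unfolding is_cellular_sheaf_def j by blast
qed

lemma endpoints_in: "e \<in> edges F \<Longrightarrow> fst (orient F e) \<in> e \<and> snd (orient F e) \<in> e"
  by (elim edge_endpoints) simp

lemma coboundary_nth:
  "coboundary F x $ e = (if e \<in> edges F
     then restr F (fst (orient F e)) e (x $ fst (orient F e))
        - restr F (snd (orient F e)) e (x $ snd (orient F e)) else 0)"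
  unfolding coboundary_def by (simp add: case_prod_beta)

lemma subspace_C0: "subspace (C0 F)"
  using subspace_node_stalk unfolding C0_def subspace_def by simp

lemma subspace_C1: "subspace (C1 F)"
  using subspace_edge_stalk unfolding C1_def subspace_def by simp

lemma linear_between_coboundary: "linear_between (C0 F) (C1 F) (coboundary F)"
proof -
  have r: "restr F i e ` node_stalk F i \<subseteq> edge_stalk F e"
    "\<And>v w. v \<in> node_stalk F i \<Longrightarrow> w \<in> node_stalk F i \<Longrightarrow> restr F i e (v + w) = restr F i e v + restr F i e w"
    "\<And>c v. v \<in> node_stalk F i \<Longrightarrow> restr F i e (c *\<^sub>R v) = c *\<^sub>R restr F i e v"
    if "e \<in> edges F" "i \<in> e" for e i
    using linear_between_restr[OF that] unfolding linear_between_def by blast+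
  have "coboundary F x \<in> C1 F" if x: "x \<in> C0 F" for x
    unfolding C1_def mem_Collect_eq coboundary_nth
  proof (intro conjI ballI allI impI)
    fix e assume e: "e \<in> edges F"
    have "restr F i e (x $ i) \<in> edge_stalk F e" if "i \<in> e" for i
      using r(1)[OF e that] x unfolding C0_def by blast
    then show "(if e \<in> edges F
     then restr F (fst (orient F e)) e (x $ fst (orient F e))
        - restr F (snd (orient F e)) e (x $ snd (orient F e)) else 0) \<in> edge_stalk F e"
      using e endpoints_in[OF e] subspace_diff[OF subspace_edge_stalk[OF e]] by simp
  qed simp
  moreover have "coboundary F (x + y) = coboundary F x + coboundary F y"
    if "x \<in> C0 F" "y \<in> C0 F" for x y
    using that endpoints_in unfolding C0_def vec_eq_iff by (simp add: coboundary_nth r(2))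
  moreover have "coboundary F (c *\<^sub>R x) = c *\<^sub>R coboundary F x" if "x \<in> C0 F" for c x
    using that endpoints_in unfolding C0_def vec_eq_iff
    by (simp add: coboundary_nth r(3) scaleR_right_diff_distrib)
  ultimately show ?thesis unfolding linear_between_def by blast
qed

lemma inner_C1: "y \<in> C1 F \<Longrightarrow> inner z y = (\<Sum>e\<in>edges F. inner (z $ e) (y $ e))"
  unfolding inner_vec_def C1_def by (intro sum.mono_neutral_right) auto

lemma norm_squared_C1: "y \<in> C1 F \<Longrightarrow> (norm y)\<^sup>2 = (\<Sum>e\<in>edges F. (norm (y $ e))\<^sup>2)"
  by (simp add: power2_norm_eq_inner inner_C1)

text \<open>The potential is separable, so its gradient, convexity and smoothness can be read off edge by
  edge; the coordinates indexed by non-edges have to vanish for the gradient to lie in \<open>C1 F\<close>.\<close>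

lemma global_potential_gradient:
  assumes y: "y \<in> C1 F"
  shows "(global_potential F U has_derivative
      inner (\<chi> e. if e \<in> edges F then grad_on (edge_stalk F e) (U e) (y $ e) else 0)) (at y within C1 F)"
    and "grad_on (C1 F) (global_potential F U) y
      = (\<chi> e. if e \<in> edges F then grad_on (edge_stalk F e) (U e) (y $ e) else 0)"
proof -
  let ?v = "\<chi> e. if e \<in> edges F then grad_on (edge_stalk F e) (U e) (y $ e) else 0"
  have U: "U e differentiable_on edge_stalk F e" and ye: "y $ e \<in> edge_stalk F e" if "e \<in> edges F" for e
    using coord y that unfolding coordination_sheaf_def C1_def by auto
  have "((\<lambda>y. \<Sum>e\<in>edges F. U e (y $ e)) has_derivative
      (\<lambda>h. \<Sum>e\<in>edges F. inner (grad_on (edge_stalk F e) (U e) (y $ e)) (h $ e))) (at y within C1 F)"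
  proof (rule has_derivative_sum)
    fix e assume e: "e \<in> edges F"
    have nth: "((\<lambda>y. y $ e) has_derivative (\<lambda>h. h $ e)) (at y within C1 F)"
      by (rule bounded_linear_imp_has_derivative) (rule bounded_linear_vec_nth)
    have "(U e has_derivative (\<lambda>h. inner (grad_on (edge_stalk F e) (U e) (y $ e)) h))
        (at (y $ e) within (\<lambda>y. y $ e) ` C1 F)"
      using has_derivative_grad_on[OF subspace_edge_stalk[OF e] U[OF e] ye[OF e]]
      by (rule has_derivative_subset) (use e in \<open>auto simp: C1_def\<close>)
    from has_derivative_in_compose[OF nth this]
    show "((\<lambda>y. U e (y $ e)) has_derivative
      (\<lambda>h. inner (grad_on (edge_stalk F e) (U e) (y $ e)) (h $ e))) (at y within C1 F)" .
  qed
  moreover have "(\<lambda>h. \<Sum>e\<in>edges F. inner (grad_on (edge_stalk F e) (U e) (y $ e)) (h $ e)) = inner ?v"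
  proof
    fix h
    have "inner ?v h = (\<Sum>e\<in>edges F. inner (?v $ e) (h $ e))"
      unfolding inner_vec_def by (intro sum.mono_neutral_right) auto
    then show "(\<Sum>e\<in>edges F. inner (grad_on (edge_stalk F e) (U e) (y $ e)) (h $ e)) = inner ?v h"
      by simp
  qed
  moreover have "global_potential F U = (\<lambda>y. \<Sum>e\<in>edges F. U e (y $ e))"
    unfolding global_potential_def ..
  ultimately show d: "(global_potential F U has_derivative inner ?v) (at y within C1 F)" by simp
  have "?v \<in> C1 F"
    unfolding C1_def using grad_on_in[OF subspace_edge_stalk U ye] by simp
  with d show "grad_on (C1 F) (global_potential F U) y = ?v"
    by (intro grad_on_eqI[OF subspace_C1 y]) auto
qed

lemma grad_global_potential_nth:
  "y \<in> C1 F \<Longrightarrow> e \<in> edges F \<Longrightarrow>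
    grad_on (C1 F) (global_potential F U) y $ e = grad_on (edge_stalk F e) (U e) (y $ e)"
  by (simp add: global_potential_gradient(2))

lemma global_potential_differentiable: "global_potential F U differentiable_on C1 F"
  unfolding differentiable_on_def differentiable_def using global_potential_gradient(1) by blast

lemma strongly_convex_global_potential:
  assumes "\<And>e. e \<in> edges F \<Longrightarrow> 0 < m e \<and> strongly_convex_on (edge_stalk F e) (m e) (U e)"
  obtains m0 where "0 < m0" "strongly_convex_on (C1 F) m0 (global_potential F U)"
proof -
  define m0 where "m0 = Min (insert 1 (m ` edges F))"
  have "0 < m0" unfolding m0_def using assms by simp
  have m0: "m0 \<le> m e" if "e \<in> edges F" for e unfolding m0_def using that by simp
  have "m0 * (norm (y - y'))\<^sup>2
      \<le> inner (grad_on (C1 F) (global_potential F U) y - grad_on (C1 F) (global_potential F U) y') (y - y')"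
    if y: "y \<in> C1 F" and y': "y' \<in> C1 F" for y y'
  proof -
    have d: "y - y' \<in> C1 F" by (rule subspace_diff[OF subspace_C1 y y'])
    have "m0 * (norm ((y - y') $ e))\<^sup>2
      \<le> inner ((grad_on (C1 F) (global_potential F U) y - grad_on (C1 F) (global_potential F U) y') $ e) ((y - y') $ e)"
      if e: "e \<in> edges F" for e
    proof -
      have "m0 * (norm ((y - y') $ e))\<^sup>2 \<le> m e * (norm (y $ e - y' $ e))\<^sup>2"
        using m0[OF e] by (simp add: mult_right_mono)
      also have "\<dots> \<le> inner (grad_on (edge_stalk F e) (U e) (y $ e) - grad_on (edge_stalk F e) (U e) (y' $ e)) (y $ e - y' $ e)"
        using assms[OF e] y y' e unfolding strongly_convex_on_def C1_def by blast
      finally show ?thesis using e y y' by (simp add: grad_global_potential_nth)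
    qed
    then show ?thesis
      unfolding norm_squared_C1[OF d] inner_C1[OF d] sum_distrib_left by (rule sum_mono)
  qed
  with that \<open>0 < m0\<close> show thesis unfolding strongly_convex_on_def by blast
qed

lemma smooth_global_potential:
  assumes "\<And>e. e \<in> edges F \<Longrightarrow> 0 < K e \<and> smooth_on_with (edge_stalk F e) (K e) (U e)"
  obtains K0 where "0 \<le> K0" "smooth_on_with (C1 F) K0 (global_potential F U)"
proof -
  define K0 where "K0 = sum K (edges F)"
  have "0 \<le> K0" unfolding K0_def using assms by (intro sum_nonneg) (simp add: less_imp_le)
  have K0: "K e \<le> K0" if "e \<in> edges F" for e
    unfolding K0_def using assms that by (intro member_le_sum) (auto intro: less_imp_le)
  let ?G = "grad_on (C1 F) (global_potential F U)"
  have "norm (?G y - ?G y') \<le> K0 * norm (y - y')" if y: "y \<in> C1 F" and y': "y' \<in> C1 F" for y y'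
  proof -
    have d: "y - y' \<in> C1 F" by (rule subspace_diff[OF subspace_C1 y y'])
    have Gd: "?G y - ?G y' \<in> C1 F"
      using grad_on_in[OF subspace_C1 global_potential_differentiable] y y' subspace_diff[OF subspace_C1] by blast
    have "(norm ((?G y - ?G y') $ e))\<^sup>2 \<le> K0\<^sup>2 * (norm ((y - y') $ e))\<^sup>2" if e: "e \<in> edges F" for e
    proof -
      have "norm ((?G y - ?G y') $ e) \<le> K e * norm (y $ e - y' $ e)"
        using assms[OF e] y y' e unfolding smooth_on_with_def
        by (simp add: grad_global_potential_nth) (simp add: C1_def)
      also have "\<dots> \<le> K0 * norm (y $ e - y' $ e)"
        using K0[OF e] by (intro mult_right_mono) auto
      finally have "(norm ((?G y - ?G y') $ e))\<^sup>2 \<le> (K0 * norm (y $ e - y' $ e))\<^sup>2"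
        by (intro power_mono) auto
      then show ?thesis by (simp add: power_mult_distrib)
    qed
    then have "(norm (?G y - ?G y'))\<^sup>2 \<le> (K0 * norm (y - y'))\<^sup>2"
      unfolding norm_squared_C1[OF Gd] power_mult_distrib norm_squared_C1[OF d] sum_distrib_left
      by (rule sum_mono)
    then show ?thesis by (rule power2_le_imp_le) (use \<open>0 \<le> K0\<close> in simp)
  qed
  with that \<open>0 \<le> K0\<close> show thesis unfolding smooth_on_with_def by blast
qed

text \<open>The Laplacian is local: testing it against a cochain supported at \<open>i\<close> involves only the edges
  at \<open>i\<close>. This is why delays need to be bounded along edges only.\<close>

lemma sheaf_laplacian_local:
  assumes x: "x \<in> C0 F" and y: "y \<in> C0 F"
    and agree: "\<And>j. j = i \<or> j \<in> nbrs F i \<Longrightarrow> x $ j = y $ j"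
  shows "sheaf_laplacian F U x $ i = sheaf_laplacian F U y $ i"
proof (rule eq_if_inner_eq_on_subspace[OF subspace_node_stalk])
  note adj = adjoint_on[OF subspace_C0 linear_between_coboundary]
  show "sheaf_laplacian F U x $ i \<in> node_stalk F i" "sheaf_laplacian F U y $ i \<in> node_stalk F i"
    using adj(1) unfolding sheaf_laplacian_def C0_def by simp_all
  fix v assume v: "v \<in> node_stalk F i"
  have ax: "axis i v \<in> C0 F"
    using v subspace_0[OF subspace_node_stalk] unfolding C0_def by (simp add: axis_def)
  have dC1: "coboundary F w \<in> C1 F" if "w \<in> C0 F" for w
    using linear_between_coboundary that unfolding linear_between_def by blast
  have test: "inner v (sheaf_laplacian F U w $ i) = (\<Sum>e\<in>edges F. inner
      (grad_on (edge_stalk F e) (U e) (coboundary F w $ e)) (coboundary F (axis i v) $ e))"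
    if w: "w \<in> C0 F" for w
  proof -
    have "inner v (sheaf_laplacian F U w $ i) = inner (axis i v) (sheaf_laplacian F U w)"
      by (simp add: inner_axis')
    also have "\<dots> = inner (grad_on (C1 F) (global_potential F U) (coboundary F w)) (coboundary F (axis i v))"
      unfolding sheaf_laplacian_def using adj(2)[OF ax] by (simp add: inner_commute)
    finally show ?thesis
      unfolding inner_C1[OF dC1[OF ax]] by (simp add: grad_global_potential_nth dC1[OF w])
  qed
  have "inner (grad_on (edge_stalk F e) (U e) (coboundary F x $ e)) (coboundary F (axis i v) $ e)
      = inner (grad_on (edge_stalk F e) (U e) (coboundary F y $ e)) (coboundary F (axis i v) $ e)"
    if e: "e \<in> edges F" for e
  proof (cases "i \<in> e")
    case True
    have "j = i \<or> j \<in> nbrs F i" if "j \<in> e" for j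
    proof (cases "j = i")
      case False
      obtain a b where "e = {a, b}" using edge_endpoints[OF e] .
      with False True that have "e = {i, j}" by auto
      with e show ?thesis unfolding nbrs_def by simp
    qed simp
    with agree have "x $ j = y $ j" if "j \<in> e" for j using that by blast
    then have "coboundary F x $ e = coboundary F y $ e"
      using endpoints_in[OF e] by (simp add: coboundary_nth)
    then show ?thesis by simp
  next
    case False
    have zero: "restr F j e 0 = 0" if "j \<in> e" for j
    proof -
      have "restr F j e (0 *\<^sub>R 0) = 0 *\<^sub>R restr F j e 0"
        using linear_between_restr[OF e that] subspace_0[OF subspace_node_stalk]
        unfolding linear_between_def by blast
      then show ?thesis by simp
    qed
    have "fst (orient F e) \<noteq> i" "snd (orient F e) \<noteq> i"
      using endpoints_in[OF e] False by auto
    then have "coboundary F (axis i v) $ e = 0"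
      using endpoints_in[OF e] by (simp add: coboundary_nth axis_def zero)
    then show ?thesis by simp
  qed
  then show "inner v (sheaf_laplacian F U x $ i) = inner v (sheaf_laplacian F U y $ i)"
    unfolding test[OF x] test[OF y] by (rule sum.cong[OF refl])
qed

lemma async_sheaf_diffusion_in_C0:
  assumes "async_sheaf_diffusion F U T \<tau> \<gamma> x"
  shows "x t \<in> C0 F"
proof -
  have lap: "sheaf_laplacian F U w \<in> C0 F" for w
    using adjoint_on_in[OF subspace_C0 linear_between_coboundary] unfolding sheaf_laplacian_def by simp
  have nat: "x (int k) \<in> C0 F" for k
  proof (induction k)
    case 0
    show ?case using assms unfolding async_sheaf_diffusion_def by simp
  next
    case (Suc k)
    have "x (int k + 1) $ i \<in> node_stalk F i" for i
      using assms Suc lap subspace_diff[OF subspace_node_stalk] subspace_scale[OF subspace_node_stalk]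
      unfolding async_sheaf_diffusion_def C0_def by simp
    then show ?case unfolding C0_def by (simp add: add.commute)
  qed
  show ?thesis
  proof (cases "t < 0")
    case True
    then show ?thesis using assms unfolding async_sheaf_diffusion_def by simp
  next
    case False
    then show ?thesis using nat[of "nat t"] by simp
  qed
qed

lemma async_sheaf_diffusion_update:
  assumes async: "partially_asynchronous F B T \<tau>" and run: "async_sheaf_diffusion F U T \<tau> \<gamma> x"
    and k: "k \<in> T i"
  shows "\<exists>z\<in>C0 F. (\<forall>j. \<exists>u. int k - int B \<le> u \<and> u \<le> int k \<and> z $ j = x u $ j)
        \<and> x (int k + 1) $ i = x (int k) $ i - \<gamma> *\<^sub>R (sheaf_laplacian F U z $ i)"
proof -
  let ?w = "\<chi> j. x (\<tau> i j k) $ j"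
  \<comment> \<open>Dates of non-neighbours are unconstrained, so those coordinates are replaced by current ones.\<close>
  let ?z = "\<chi> j. if j = i \<or> j \<in> nbrs F i then x (\<tau> i j k) $ j else x (int k) $ j"
  have w: "?w \<in> C0 F" and z: "?z \<in> C0 F"
    using async_sheaf_diffusion_in_C0[OF run] unfolding C0_def by simp_all
  have "\<exists>u. int k - int B \<le> u \<and> u \<le> int k \<and> ?z $ j = x u $ j" for j
  proof (cases "j = i \<or> j \<in> nbrs F i")
    case True
    with async k have "int k - int B \<le> \<tau> i j k" "\<tau> i j k \<le> int k"
      unfolding partially_asynchronous_def by auto
    with True show ?thesis by auto
  next
    case False
    then show ?thesis by (intro exI[of _ "int k"]) simp
  qed
  moreover have "x (int k + 1) $ i = x (int k) $ i - \<gamma> *\<^sub>R (sheaf_laplacian F U ?z $ i)"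
    using run k sheaf_laplacian_local[OF w z, of i] unfolding async_sheaf_diffusion_def by simp
  ultimately show ?thesis using z by blast
qed

end

section \<open>Linear convergence of partially asynchronous sheaf diffusion\<close>

theorem theorem1:
  fixes F :: "('v::finite, 'a::euclidean_space, 'b::euclidean_space) cellular_sheaf"
    and U :: "'v set \<Rightarrow> 'b \<Rightarrow> real"
    and m K :: "'v set \<Rightarrow> real"
    and B :: nat
    and T :: "'v \<Rightarrow> nat set"
    and \<tau> :: "'v \<Rightarrow> 'v \<Rightarrow> nat \<Rightarrow> int"
  assumes "coordination_sheaf F U"
    and "\<And>e. e \<in> edges F \<Longrightarrow> m e > 0 \<and> strongly_convex_on (edge_stalk F e) (m e) (U e)"
    and "\<And>e. e \<in> edges F \<Longrightarrow> K e > 0 \<and> smooth_on_with (edge_stalk F e) (K e) (U e)"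
    and "minimizers F U \<noteq> {}"
    and "partially_asynchronous F B T \<tau>"
  shows "\<exists>\<gamma>0>0. \<forall>\<gamma>. 0 < \<gamma> \<and> \<gamma> < \<gamma>0 \<longrightarrow>
    (\<forall>x. async_sheaf_diffusion F U T \<tau> \<gamma> x \<longrightarrow>
      (\<exists>a b c. a > 0 \<and> b > 0 \<and> c > 0 \<and> c < 1 / \<gamma> \<and>
        (\<forall>r::nat.
          energy_gap F U x (int (r * (B + 1))) \<le> a * (1 - \<gamma> * c) ^ r \<and>
          recent_variation B x (int (r * (B + 1))) \<le> b * (1 - \<gamma> * c) ^ r)))"
proof -
  note S0 = subspace_C0[OF assms(1)] and S1 = subspace_C1[OF assms(1)]
  obtain m0 where m0: "0 < m0" "strongly_convex_on (C1 F) m0 (global_potential F U)"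
    using strongly_convex_global_potential[OF assms(1,2)] by blast
  obtain K0 where K0: "0 \<le> K0" "smooth_on_with (C1 F) K0 (global_potential F U)"
    using smooth_global_potential[OF assms(1,3)] by blast
  interpret strongly_convex_composite "C0 F" "C1 F" "coboundary F" "global_potential F U" m0 K0
    by unfold_locales
      (fact S0 S1 linear_between_coboundary[OF assms(1)] global_potential_differentiable[OF assms(1)] m0 K0)+
  have lap: "gradient = sheaf_laplacian F U"
    unfolding sheaf_laplacian_def gradient_def by (simp add: fun_eq_iff)
  have energy: "dirichlet_energy F U w = global_potential F U (coboundary F w)" for w
    unfolding dirichlet_energy_def by simp
  obtain y where y: "y \<in> C0 F" "gradient y = 0"
    using assms(4) unfolding minimizers_def lap by blast
  \<comment> \<open>By convexity the infimum is attained at the given stationary point.\<close>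
  have min: "min_energy F U = dirichlet_energy F U y"
    unfolding min_energy_def energy
    by (rule cInf_eq_minimum) (use y stationary_imp_minimizer in auto)
  obtain \<Lambda> where \<Lambda>: "0 \<le> \<Lambda>"
    "\<And>v w. v \<in> C0 F \<Longrightarrow> w \<in> C0 F \<Longrightarrow> norm (gradient v - gradient w) \<le> \<Lambda> * norm (v - w)"
    "\<And>v w. v \<in> C0 F \<Longrightarrow> w \<in> C0 F \<Longrightarrow> global_potential F U (coboundary F w)
      \<le> global_potential F U (coboundary F v) + inner (gradient v) (w - v) + \<Lambda> * (norm (w - v))\<^sup>2"
    using gradient_Lipschitz_and_upper_bound by blast
  obtain P where P: "0 \<le> P" "\<And>v. v \<in> C0 F \<Longrightarrow> global_potential F U (coboundary F v)
      - global_potential F U (coboundary F y) \<le> P * (norm (gradient v))\<^sup>2"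
    using gap_le_gradient_squared[OF y] by blast
  define \<gamma>0 where "\<gamma>0 = 1 / (4 * (1 + \<Lambda> + CARD('v) * \<Lambda>\<^sup>2 * (real B + 1)\<^sup>2))"
  have "0 < \<gamma>0"
  proof -
    have "0 \<le> CARD('v) * \<Lambda>\<^sup>2 * (real B + 1)\<^sup>2" by simp
    with \<Lambda>(1) show ?thesis unfolding \<gamma>0_def by (simp add: add_pos_nonneg)
  qed
  moreover have "\<exists>a b c. a > 0 \<and> b > 0 \<and> c > 0 \<and> c < 1 / \<gamma> \<and>
        (\<forall>r::nat.
          energy_gap F U x (int (r * (B + 1))) \<le> a * (1 - \<gamma> * c) ^ r \<and>
          recent_variation B x (int (r * (B + 1))) \<le> b * (1 - \<gamma> * c) ^ r)"
    if step: "0 < \<gamma>" "\<gamma> < \<gamma>0" and run: "async_sheaf_diffusion F U T \<tau> \<gamma> x" for \<gamma> x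
  proof -
    interpret partially_asynchronous_descent "C0 F"
      "\<lambda>v. dirichlet_energy F U v - min_energy F U" gradient \<Lambda> P B T \<gamma> x
    proof unfold_locales
      show "x t \<in> C0 F" for t by (rule async_sheaf_diffusion_in_C0[OF assms(1) run])
      show "0 \<le> dirichlet_energy F U v - min_energy F U" if "v \<in> C0 F" for v
        using stationary_imp_minimizer[OF that y] unfolding min energy by simp
      show "{k..k + B} \<inter> T i \<noteq> {}" for k i
        using assms(5) unfolding partially_asynchronous_def by blast
      show "x (int k + 1) $ i = x (int k) $ i" if "k \<notin> T i" for k i
        using run that unfolding async_sheaf_diffusion_def by simp
      show "\<exists>z\<in>C0 F. (\<forall>j. \<exists>u. int k - int B \<le> u \<and> u \<le> int k \<and> z $ j = x u $ j)
          \<and> x (int k + 1) $ i = x (int k) $ i - \<gamma> *\<^sub>R (gradient z $ i)" if "k \<in> T i" for k i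
        unfolding lap by (rule async_sheaf_diffusion_update[OF assms(1,5) run that])
    qed (use \<Lambda> P step(1) in \<open>simp_all add: min energy add.assoc\<close>)
    show ?thesis
      using linear_convergence[OF step(2)[unfolded \<gamma>0_def]] unfolding energy_gap_def .
  qed
  ultimately show ?thesis by blast
qed

end
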